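(* Let $A$ be a real $n\times n$ matrix and $b\in\mathbb{R}^n$, and let $I,J$ be sub-sequences of $1,2,\dots,n$ such that $A_{I,J}$ is a computable projection of the system $Ax=b$. Then the system $Ax=b$ has a solution $\xi\in\mathbb{R}^n$ if and only if there exists a vector $\alpha\in\mathbb{R}^{|J|}$ such that $A_{I,J}\,\alpha=b_I$. Furthermore, for any such $\alpha$, the vector $\mathrm{lift}(\alpha,J,n)$ is a solution of $Ax=b$.
   Context: For sub-sequences $I,J$ of $1,2,\dots,n$ (also regarded as sets; possibly empty), the $(I,J)$-projection $A_{I,J}$ of an $n\times n$ matrix $A$ is the $|I|\times|J|$ matrix with $A_{I,J}[r,s]=A[I[r],J[s]]$. For $b\in\mathbb{R}^n$, $b_I$ is the vector of length $|I|$ with $b_I[r]=b[I[r]]$. With $B=\{i\mid b[i]\neq 0\}$, $A_{I,J}$ is called a computable projection of the system $Ax=b$ if (i) $B\subseteq I$; (ii) $\{i\mid A[i,j]\neq 0\text{ for some } j\in J\}\subseteq I$; (iii) $\{j\mid A[i,j]\neq 0\text{ for some } i\in I\}\subseteq J$. For a sub-sequence $J$ of $1,\dots,n$ and a vector $\alpha$ of length $|J|$, $\mathrm{lift}(\alpha,J,n)\in\mathbb{R}^n$ is the vector with $\mathrm{lift}(\alpha,J,n)[i]=\alpha[s]$ if $J[s]=i$, and $\mathrm{lift}(\alpha,J,n)[i]=0$ if $i\notin J$. *)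

theory Defs
  imports "Jordan_Normal_Form.Matrix" "HOL-Library.Sublist"
begin

(* Indices are shifted by one to follow the 0-based convention of Jordan_Normal_Form:
   a sub-sequence of 1,2,...,n becomes a list I with  subseq I [0..<n],  and the r-th entry
   of such a list is  I ! r  with r < length I. *)

definition mat_projection :: "'a mat \<Rightarrow> nat list \<Rightarrow> nat list \<Rightarrow> 'a mat" where
  "mat_projection A I J = mat (length I) (length J) (\<lambda>(r, s). A $$ (I ! r, J ! s))"

definition vec_projection :: "'a vec \<Rightarrow> nat list \<Rightarrow> 'a vec" where
  "vec_projection b I = vec (length I) (\<lambda>r. b $ (I ! r))"

definition computable_projection ::
    "'a::zero mat \<Rightarrow> 'a vec \<Rightarrow> nat list \<Rightarrow> nat list \<Rightarrow> bool" where
  "computable_projection A b I J \<longleftrightarrow>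
     {i. i < dim_vec b \<and> b $ i \<noteq> 0} \<subseteq> set I \<and>
     {i. i < dim_row A \<and> (\<exists>j \<in> set J. A $$ (i, j) \<noteq> 0)} \<subseteq> set I \<and>
     {j. j < dim_col A \<and> (\<exists>i \<in> set I. A $$ (i, j) \<noteq> 0)} \<subseteq> set J"

(* The description below determines s uniquely, because sub-sequences of [0..<n] are distinct. *)
definition lift_vec :: "'a::zero vec \<Rightarrow> nat list \<Rightarrow> nat \<Rightarrow> 'a vec" where
  "lift_vec \<alpha> J n =
     vec n (\<lambda>i. if i \<in> set J then \<alpha> $ (THE s. s < length J \<and> J ! s = i) else 0)"

end

theory Submission
  imports Defs
begin

text \<open>Restricting vectors to \<open>J\<close> and \<open>I\<close> intertwines \<open>A\<close> with its projection, because the rows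
  indexed by \<open>I\<close> vanish outside the columns indexed by \<open>J\<close>. So a solution restricts to a solution of
  the projected system. Conversely, a lifted vector restricts back to the vector it came from, which
  settles the equations indexed by \<open>I\<close>; in every other equation both sides are zero.\<close>

lemma lift_vec_carrier: "lift_vec \<alpha> J n \<in> carrier_vec n"
  by (simp add: lift_vec_def)

lemma lift_vec_outside: "i < n \<Longrightarrow> i \<notin> set J \<Longrightarrow> lift_vec \<alpha> J n $ i = 0"
  by (simp add: lift_vec_def)

lemma vec_projection_carrier: "vec_projection b I \<in> carrier_vec (length I)"
  by (simp add: vec_projection_def)

text \<open>Since \<open>J\<close> has no repetitions, \<open>s\<close> is the only position of
  \<open>J ! s\<close>, so the description in \<open>lift_vec\<close> selects exactly the entry that
  the projection reads back.\<close>

lemma vec_projection_lift_vec: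
  assumes "distinct J" and "set J \<subseteq> {..<n}" and "\<alpha> \<in> carrier_vec (length J)"
  shows "vec_projection (lift_vec \<alpha> J n) J = \<alpha>"
proof (rule eq_vecI)
  fix s assume "s < dim_vec \<alpha>"
  with assms(3) have s: "s < length J" by simp
  then have "(THE s'. s' < length J \<and> J ! s' = J ! s) = s"
    using assms(1) by (auto simp: nth_eq_iff_index_eq)
  moreover have "J ! s < n"
    using s assms(2) nth_mem by blast
  ultimately show "vec_projection (lift_vec \<alpha> J n) J $ s = \<alpha> $ s"
    using s by (simp add: vec_projection_def lift_vec_def)
qed (use assms(3) in \<open>simp add: vec_projection_def\<close>)

lemma vec_projection_eqD:
  assumes "vec_projection v I = vec_projection w I" and "i \<in> set I"
  shows "v $ i = w $ i"
proof -
  obtain r where "r < length I" "I ! r = i"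
    using assms(2) by (auto simp: in_set_conv_nth)
  with arg_cong[OF assms(1), of "\<lambda>u. u $ r"] show ?thesis
    by (simp add: vec_projection_def)
qed

text \<open>Kept general in \<open>v\<close> so that it serves both directions: for a given solution
  and for a lifted vector.\<close>

lemma mat_projection_mult_vec_projection:
  fixes A :: "'a::semiring_0 mat"
  assumes A: "A \<in> carrier_mat m n" and v: "v \<in> carrier_vec n"
    and I: "set I \<subseteq> {..<m}" and J: "distinct J" "set J \<subseteq> {..<n}"
    and zero: "\<And>i j. i \<in> set I \<Longrightarrow> j < n \<Longrightarrow> j \<notin> set J \<Longrightarrow> A $$ (i, j) = 0"
  shows "mat_projection A I J *\<^sub>v vec_projection v J = vec_projection (A *\<^sub>v v) I"
proof (rule eq_vecI)
  fix r assume "r < dim_vec (vec_projection (A *\<^sub>v v) I)"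
  then have r: "r < length I" by (simp add: vec_projection_def)
  then have i: "I ! r \<in> set I" "I ! r < m"
    using I nth_mem by blast+
  have "(mat_projection A I J *\<^sub>v vec_projection v J) $ r
      = (\<Sum>s<length J. A $$ (I ! r, J ! s) * v $ (J ! s))"
    using r by (simp add: mat_projection_def vec_projection_def scalar_prod_def lessThan_atLeast0)
  \<comment> \<open>Distinctness makes positions in \<open>J\<close> correspond bijectively to its
    members.\<close>
  also have "\<dots> = (\<Sum>j\<in>set J. A $$ (I ! r, j) * v $ j)"
    by (rule sum.reindex_bij_betw) (rule bij_betw_nth[OF J(1) refl refl])
  \<comment> \<open>The columns added here lie outside \<open>J\<close>, where row
    \<open>I ! r\<close> is zero.\<close>
  also have "\<dots> = (\<Sum>j<n. A $$ (I ! r, j) * v $ j)"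
    using J(2) zero[OF i(1)] by (intro sum.mono_neutral_left) auto
  also have "\<dots> = vec_projection (A *\<^sub>v v) I $ r"
    using A v r i(2) by (simp add: vec_projection_def scalar_prod_def lessThan_atLeast0)
  finally show "(mat_projection A I J *\<^sub>v vec_projection v J) $ r = vec_projection (A *\<^sub>v v) I $ r" .
qed (simp add: mat_projection_def vec_projection_def)

text \<open>Every term of the row sum has a zero factor: the matrix entry if the column is in
  \<open>J\<close>, the lifted entry otherwise.\<close>

lemma mult_mat_lift_vec_outside:
  fixes A :: "'a::semiring_0 mat"
  assumes "A \<in> carrier_mat m n" and "i < m" and "\<And>j. j \<in> set J \<Longrightarrow> A $$ (i, j) = 0"
  shows "(A *\<^sub>v lift_vec \<alpha> J n) $ i = 0"
proof -
  have "A $$ (i, j) * lift_vec \<alpha> J n $ j = 0" if "j < n" for j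
    using that assms(3) by (cases "j \<in> set J") (simp_all add: lift_vec_outside)
  then show ?thesis
    using assms(1,2) lift_vec_carrier[of \<alpha> J n] by (simp add: scalar_prod_def)
qed

theorem theorem1:
  fixes A :: "real mat" and b :: "real vec" and n :: nat and I J :: "nat list"
  assumes "A \<in> carrier_mat n n" and "b \<in> carrier_vec n"
    and "subseq I [0..<n]" and "subseq J [0..<n]"
    and "computable_projection A b I J"
  shows "((\<exists>\<xi> \<in> carrier_vec n. A *\<^sub>v \<xi> = b) \<longleftrightarrow>
          (\<exists>\<alpha> \<in> carrier_vec (length J). mat_projection A I J *\<^sub>v \<alpha> = vec_projection b I)) \<and>
         (\<forall>\<alpha> \<in> carrier_vec (length J). mat_projection A I J *\<^sub>v \<alpha> = vec_projection b I \<longrightarrow>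
            lift_vec \<alpha> J n \<in> carrier_vec n \<and> A *\<^sub>v lift_vec \<alpha> J n = b)"
proof -
  note A = assms(1) and b = assms(2)
  have I: "set I \<subseteq> {..<n}" and J: "set J \<subseteq> {..<n}"
    using assms(3,4) by (auto elim: list_emb_set)
  have dJ: "distinct J"
    using assms(4) by (intro subseqs_distinctD[of J "[0..<n]"]) auto
  \<comment> \<open>Contrapositives of the three inclusions defining a computable projection: the
    first two give \<open>b0\<close> and \<open>row0\<close>, the third gives
    \<open>col0\<close>.\<close>
  have b0: "b $ i = 0" and row0: "\<And>j. j \<in> set J \<Longrightarrow> A $$ (i, j) = 0"
    if "i < n" "i \<notin> set I" for i
    using assms(5) A b that by (auto simp: computable_projection_def)
  have col0: "A $$ (i, j) = 0" if "i \<in> set I" "j < n" "j \<notin> set J" for i j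
    using assms(5) A that by (auto simp: computable_projection_def)
  note proj = mat_projection_mult_vec_projection[OF A _ I dJ J col0]
  have lift: "A *\<^sub>v lift_vec \<alpha> J n = b"
    if \<alpha>: "\<alpha> \<in> carrier_vec (length J)" and eq: "mat_projection A I J *\<^sub>v \<alpha> = vec_projection b I"
    for \<alpha>
  proof (rule eq_vecI)
    fix i assume "i < dim_vec b"
    with b have i: "i < n" by simp
    show "(A *\<^sub>v lift_vec \<alpha> J n) $ i = b $ i"
    proof (cases "i \<in> set I")
      case True
      \<comment> \<open>Here \<open>proj\<close> is applied to the lifted vector, whose projection
        to \<open>J\<close> is \<alpha> again.\<close>
      have "vec_projection (A *\<^sub>v lift_vec \<alpha> J n) I = vec_projection b I"
        using proj[OF lift_vec_carrier, of \<alpha> J] eq by (simp add: vec_projection_lift_vec[OF dJ J \<alpha>])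
      then show ?thesis
        using True by (rule vec_projection_eqD)
    next
      case False
      then show ?thesis
        using mult_mat_lift_vec_outside[OF A i row0[OF i False]] b0[OF i False] by simp
    qed
  qed (use A b in simp)
  \<comment> \<open>This supplies the witness for the forward direction; \<open>lift\<close> gives
    both the converse and the final claim.\<close>
  have restrict: "mat_projection A I J *\<^sub>v vec_projection \<xi> J = vec_projection b I"
    if "\<xi> \<in> carrier_vec n" "A *\<^sub>v \<xi> = b" for \<xi>
    using proj[OF that(1)] that(2) by simp
  show ?thesis
    using lift restrict lift_vec_carrier vec_projection_carrier by blast
qed

end
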